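(* Let $n,m\in\mathbb{Z}_{>0}$, $A\in\mathbb{R}^{n\times n}$, $B\in\mathbb{R}^{n\times m}$ with $(A,B)$ stabilizable, and let $Q\in\mathbb{R}^{n\times n}$, $R\in\mathbb{R}^{m\times m}$ be symmetric with $Q\succ 0$ and $R\succ 0$. Fix any $\gamma\in[0,1]$. Let $P_\gamma=P_\gamma^\top\succ 0$ be the (unique symmetric positive definite) solution to $$P_\gamma=\gamma A^\top P_\gamma A-\gamma^2A^\top P_\gamma B(R+\gamma B^\top P_\gamma B)^{-1}B^\top P_\gamma A+Q,$$ and let $K_\gamma:=-\gamma(R+\gamma B^\top P_\gamma B)^{-1}B^\top P_\gamma A$. If $$\gamma^2P_\gamma BR^{-1}B^\top P_\gamma+Q+(\gamma-1)P_\gamma\succ 0,$$ then $K_\gamma\in\mathcal{K}_1$, i.e., $\rho(A+BK_\gamma)<1$.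
   Context: $\rho(M)$ denotes the spectral radius of a square matrix $M$. For a symmetric matrix, $\succ 0$ means positive definite. $(A,B)$ stabilizable means there is $K\in\mathbb{R}^{m\times n}$ with $\rho(A+BK)<1$. $\mathcal{K}_1:=\{K\in\mathbb{R}^{m\times n}:\rho(A+BK)<1\}$. Under the stated assumptions the discounted Riccati equation in the claim has a unique symmetric positive definite solution $P_\gamma$ (known fact), and $u=K_\gamma x$ is the optimal feedback for the system $x_{k+1}=Ax_k+Bu_k$ with cost $\sum_{k\ge0}\gamma^k(x_k^\top Qx_k+u_k^\top Ru_k)$. *)

theory Defs
  imports
    "Jordan_Normal_Form.Gauss_Jordan_Elimination"
    "Jordan_Normal_Form.Determinant"
    "Jordan_Normal_Form.Spectral_Radius"
begin

text \<open>The value of \<^term>\<open>mat_inv M\<close> is meaningful only for invertible \<open>M\<close>; see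
  the lemma \<open>mat_inv\<close> below.\<close>

definition mat_inv :: "'a :: field mat \<Rightarrow> 'a mat" where
  "mat_inv M = the (mat_inverse M)"

lemma mat_inv:
  fixes M :: "'a :: field mat"
  assumes M: "M \<in> carrier_mat n n" and det: "det M \<noteq> 0"
  shows "mat_inv M \<in> carrier_mat n n"
    and "M * mat_inv M = 1\<^sub>m n"
    and "mat_inv M * M = 1\<^sub>m n"
proof -
  have "M \<in> Units (ring_mat TYPE('a) n ())"
    using det_non_zero_imp_unit[OF M det] .
  then obtain N where "mat_inverse M = Some N"
    using mat_inverse(1)[OF M, of "()"] by (cases "mat_inverse M") auto
  with mat_inverse(2)[OF M this]
  show "mat_inv M \<in> carrier_mat n n" "M * mat_inv M = 1\<^sub>m n" "mat_inv M * M = 1\<^sub>m n"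
    by (auto simp: mat_inv_def)
qed

definition pos_def_mat :: "nat \<Rightarrow> real mat \<Rightarrow> bool" where
  "pos_def_mat n M \<longleftrightarrow> M \<in> carrier_mat n n \<and> transpose_mat M = M \<and>
     (\<forall>x \<in> carrier_vec n. x \<noteq> 0\<^sub>v n \<longrightarrow> 0 < x \<bullet> (M *\<^sub>v x))"

text \<open>The spectral radius of a real matrix ranges over its complex eigenvalues.\<close>

definition real_spectral_radius :: "real mat \<Rightarrow> real" where
  "real_spectral_radius M = spectral_radius (map_mat complex_of_real M)"

definition stabilizing_gains :: "nat \<Rightarrow> nat \<Rightarrow> real mat \<Rightarrow> real mat \<Rightarrow> real mat set" where
  "stabilizing_gains n m A B = {K \<in> carrier_mat m n. real_spectral_radius (A + B * K) < 1}"

definition stabilizable :: "nat \<Rightarrow> nat \<Rightarrow> real mat \<Rightarrow> real mat \<Rightarrow> bool" where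
  "stabilizable n m A B \<longleftrightarrow> (\<exists>K \<in> carrier_mat m n. real_spectral_radius (A + B * K) < 1)"

end

theory Submission
  imports Defs
begin

text \<open>Put \<open>F = A + B K\<close>, \<open>G = B R\<^sup>-\<^sup>1 B\<^sup>T\<close> and \<open>M = \<gamma> P + \<gamma>\<^sup>2 P G P\<close>. The gain equation gives
  \<open>A = (1 + \<gamma> G P) F\<close>, and the Riccati equation reads \<open>P - Q = \<gamma> A\<^sup>T P F\<close>; together
  \<open>P - Q = F\<^sup>T M F\<close>. The hypothesis says exactly that \<open>M - (P - Q) = M - F\<^sup>T M F\<close> is positive
  definite, and \<open>M\<close> is positive semidefinite, so \<open>x\<^sup>T M x\<close> is a Lyapunov function for the
  undiscounted closed loop \<open>F\<close>.\<close>

section \<open>Positive definite matrices and real quadratic forms\<close>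

text \<open>A nonzero kernel vector would give the form the value 0. Phrased through the form alone,
  this serves both \<open>R\<close> and \<open>S = R + \<gamma> B^T P B\<close>.\<close>

lemma det_nonzero_if_quadratic_form_pos:
  fixes M :: "real mat"
  assumes M: "M \<in> carrier_mat n n"
    and pos: "\<And>x. x \<in> carrier_vec n \<Longrightarrow> x \<noteq> 0\<^sub>v n \<Longrightarrow> 0 < x \<bullet> (M *\<^sub>v x)"
  shows "det M \<noteq> 0"
proof
  assume "det M = 0"
  then obtain v where v: "v \<in> carrier_vec n" "v \<noteq> 0\<^sub>v n" "M *\<^sub>v v = 0\<^sub>v n"
    using det_0_iff_vec_prod_zero[OF M] by auto
  with pos[of v] show False by simp
qed

lemma pos_def_mat_det_nonzero: "pos_def_mat n M \<Longrightarrow> det M \<noteq> 0"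
  by (rule det_nonzero_if_quadratic_form_pos[of M n]) (auto simp: pos_def_mat_def)

lemma pos_def_mat_nonneg:
  assumes "pos_def_mat n M" and "x \<in> carrier_vec n"
  shows "0 \<le> x \<bullet> (M *\<^sub>v x)"
  using assms by (cases "x = 0\<^sub>v n") (auto simp: pos_def_mat_def less_imp_le)

text \<open>Substituting \<open>y = R z\<close> turns the form of the inverse at \<open>y\<close>
  into the form of \<open>R\<close> at \<open>z\<close>.\<close>

lemma pos_def_mat_inv_nonneg:
  assumes R: "pos_def_mat m R" and y: "y \<in> carrier_vec m"
  shows "0 \<le> y \<bullet> (mat_inv R *\<^sub>v y)"
proof -
  have Rc: "R \<in> carrier_mat m m" using R by (simp add: pos_def_mat_def)
  note inv = mat_inv[OF Rc pos_def_mat_det_nonzero[OF R]]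
  define z where "z = mat_inv R *\<^sub>v y"
  have z: "z \<in> carrier_vec m" using inv(1) y by (simp add: z_def)
  have "R *\<^sub>v z = y"
    using assoc_mult_mat_vec[OF Rc inv(1) y] inv(2) y by (simp add: z_def)
  moreover have "0 \<le> z \<bullet> (R *\<^sub>v z)"
    by (rule pos_def_mat_nonneg[OF R z])
  ultimately have "0 \<le> z \<bullet> y" by simp
  then show ?thesis using comm_scalar_prod[OF z y] by (simp add: z_def)
qed

lemma smult_mat_mult_mat_vec_assoc:
  fixes M :: "'a :: comm_semiring_0 mat"
  assumes "M \<in> carrier_mat n k" and "x \<in> carrier_vec k"
  shows "(c \<cdot>\<^sub>m M) *\<^sub>v x = c \<cdot>\<^sub>v (M *\<^sub>v x)"
  using assms by (intro eq_vecI) (auto simp: scalar_prod_def sum_distrib_left mult.assoc)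

text \<open>The outer factor \<open>C\<close> moves across the scalar product as its transpose. Used
  with \<open>C = B^T\<close>, \<open>N = P\<close> for the form of \<open>B^T P B\<close>, and with
  \<open>C = P B\<close>, \<open>N = R^-1\<close> for the quadratic term of the Riccati
  hypothesis.\<close>

lemma quadratic_form_conj:
  fixes C N :: "real mat"
  assumes C: "C \<in> carrier_mat n m" and N: "N \<in> carrier_mat m m" and x: "x \<in> carrier_vec n"
  shows "x \<bullet> ((C * N * transpose_mat C) *\<^sub>v x)
    = (transpose_mat C *\<^sub>v x) \<bullet> (N *\<^sub>v (transpose_mat C *\<^sub>v x))"
proof -
  have Ct: "transpose_mat C \<in> carrier_mat m n" using C by simp
  have y: "transpose_mat C *\<^sub>v x \<in> carrier_vec m" using Ct x by simp
  have "(C * N * transpose_mat C) *\<^sub>v x = C *\<^sub>v (N *\<^sub>v (transpose_mat C *\<^sub>v x))"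
    using assoc_mult_mat_vec[OF mult_carrier_mat[OF C N] Ct x] assoc_mult_mat_vec[OF C N y] by simp
  then show ?thesis
    using transpose_vec_mult_scalar[OF C, of "N *\<^sub>v (transpose_mat C *\<^sub>v x)" x] x y N
    by (simp add: C)
qed

section \<open>Lyapunov criterion in discrete time\<close>

text \<open>The two vectors are the real and imaginary parts of \<open>(a + i b)(x + i y)\<close>.
  The mixed terms \<open>x^T M y\<close> and \<open>y^T M x\<close> occur with factor
  \<open>-a b\<close> in the first form and \<open>a b\<close> in the second, so they cancel in the
  sum.\<close>

lemma quadratic_form_rotation:
  fixes M :: "real mat"
  assumes M: "M \<in> carrier_mat n n" and x: "x \<in> carrier_vec n" and y: "y \<in> carrier_vec n"
  shows "(a \<cdot>\<^sub>v x - b \<cdot>\<^sub>v y) \<bullet> (M *\<^sub>v (a \<cdot>\<^sub>v x - b \<cdot>\<^sub>v y))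
       + (a \<cdot>\<^sub>v y + b \<cdot>\<^sub>v x) \<bullet> (M *\<^sub>v (a \<cdot>\<^sub>v y + b \<cdot>\<^sub>v x))
       = (a\<^sup>2 + b\<^sup>2) * (x \<bullet> (M *\<^sub>v x) + y \<bullet> (M *\<^sub>v y))"
proof -
  have c: "a \<cdot>\<^sub>v x \<in> carrier_vec n" "b \<cdot>\<^sub>v y \<in> carrier_vec n" "a \<cdot>\<^sub>v y \<in> carrier_vec n"
    "b \<cdot>\<^sub>v x \<in> carrier_vec n" "M *\<^sub>v x \<in> carrier_vec n" "M *\<^sub>v y \<in> carrier_vec n"
    using M x y by auto
  have "M *\<^sub>v (a \<cdot>\<^sub>v x - b \<cdot>\<^sub>v y) = a \<cdot>\<^sub>v (M *\<^sub>v x) - b \<cdot>\<^sub>v (M *\<^sub>v y)"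
    using mult_minus_distrib_mat_vec[OF M c(1,2)] mult_mat_vec[OF M x] mult_mat_vec[OF M y] by simp
  moreover have "M *\<^sub>v (a \<cdot>\<^sub>v y + b \<cdot>\<^sub>v x) = a \<cdot>\<^sub>v (M *\<^sub>v y) + b \<cdot>\<^sub>v (M *\<^sub>v x)"
    using mult_add_distrib_mat_vec[OF M c(3,4)] mult_mat_vec[OF M x] mult_mat_vec[OF M y] by simp
  ultimately show ?thesis using x y c
    by (simp add: minus_scalar_prod_distrib[where n = n] scalar_prod_minus_distrib[where n = n]
        add_scalar_prod_distrib[where n = n] scalar_prod_add_distrib[where n = n]
        power2_eq_square algebra_simps)
qed

text \<open>Writing a complex eigenvector as \<open>x + \<i> y\<close>, the form evaluated at \<open>F x\<close> and \<open>F y\<close>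
  sums to \<open>\<bar>\<mu>\<bar>\<^sup>2\<close> times its sum at \<open>x\<close> and \<open>y\<close>, so strict decrease forces \<open>\<bar>\<mu>\<bar> < 1\<close>.\<close>

lemma discrete_lyapunov:
  fixes F M :: "real mat"
  assumes n: "n > 0" and F: "F \<in> carrier_mat n n" and M: "M \<in> carrier_mat n n"
    and nonneg: "\<And>x. x \<in> carrier_vec n \<Longrightarrow> 0 \<le> x \<bullet> (M *\<^sub>v x)"
    and decr: "\<And>x. x \<in> carrier_vec n \<Longrightarrow> x \<noteq> 0\<^sub>v n
      \<Longrightarrow> (F *\<^sub>v x) \<bullet> (M *\<^sub>v (F *\<^sub>v x)) < x \<bullet> (M *\<^sub>v x)"
  shows "real_spectral_radius F < 1"
proof -
  let ?F = "map_mat complex_of_real F"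
  have cF: "?F \<in> carrier_mat n n" using F by simp
  obtain \<mu> where l: "eigenvalue ?F \<mu>" "real_spectral_radius F = cmod \<mu>"
    using spectral_radius_mem_max(1)[OF cF n]
    unfolding real_spectral_radius_def spectrum_def by auto
  then obtain v where v: "v \<in> carrier_vec n" "v \<noteq> 0\<^sub>v n" "?F *\<^sub>v v = \<mu> \<cdot>\<^sub>v v"
    using F by (auto simp: eigenvalue_def eigenvector_def)
  define x y where "x = map_vec Re v" and "y = map_vec Im v"
  define a b where "a = Re \<mu>" and "b = Im \<mu>"
  have xy: "x \<in> carrier_vec n" "y \<in> carrier_vec n" using v by (auto simp: x_def y_def)
  \<comment> \<open>The coefficients are real, so taking \<open>Re\<close> and \<open>Im\<close> of
    this equation splits it into the real relations \<open>Fx\<close> and \<open>Fy\<close>.\<close>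
  have eig: "(\<Sum>j<n. complex_of_real (F $$ (i,j)) * v $ j) = \<mu> * v $ i" if "i < n" for i
  proof -
    have "(?F *\<^sub>v v) $ i = (\<Sum>j<n. complex_of_real (F $$ (i,j)) * v $ j)"
      using that F v(1) by (auto simp: scalar_prod_def atLeast0LessThan intro!: sum.cong)
    then show ?thesis using v that by simp
  qed
  have Fx: "F *\<^sub>v x = a \<cdot>\<^sub>v x - b \<cdot>\<^sub>v y"
  proof (rule eq_vecI)
    fix i assume "i < dim_vec (a \<cdot>\<^sub>v x - b \<cdot>\<^sub>v y)"
    then have i: "i < n" using xy by simp
    have "(F *\<^sub>v x) $ i = (\<Sum>j<n. F $$ (i,j) * Re (v $ j))"
      using i F v(1) by (auto simp: scalar_prod_def atLeast0LessThan x_def intro!: sum.cong)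
    also have "\<dots> = Re (\<mu> * v $ i)" using eig[OF i, symmetric] by simp
    finally show "(F *\<^sub>v x) $ i = (a \<cdot>\<^sub>v x - b \<cdot>\<^sub>v y) $ i"
      using i v(1) by (simp add: a_def b_def x_def y_def)
  qed (use F xy in auto)
  have Fy: "F *\<^sub>v y = a \<cdot>\<^sub>v y + b \<cdot>\<^sub>v x"
  proof (rule eq_vecI)
    fix i assume "i < dim_vec (a \<cdot>\<^sub>v y + b \<cdot>\<^sub>v x)"
    then have i: "i < n" using xy by simp
    have "(F *\<^sub>v y) $ i = (\<Sum>j<n. F $$ (i,j) * Im (v $ j))"
      using i F v(1) by (auto simp: scalar_prod_def atLeast0LessThan y_def intro!: sum.cong)
    also have "\<dots> = Im (\<mu> * v $ i)" using eig[OF i, symmetric] by simp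
    finally show "(F *\<^sub>v y) $ i = (a \<cdot>\<^sub>v y + b \<cdot>\<^sub>v x) $ i"
      using i v(1) by (simp add: a_def b_def x_def y_def)
  qed (use F xy in auto)
  define q where "q u = u \<bullet> (M *\<^sub>v u)" for u
  \<comment> \<open>One of the two parts may vanish, and there the decrease is only weak; strictness
    of the summed inequality comes from the nonzero part.\<close>
  have "x \<noteq> 0\<^sub>v n \<or> y \<noteq> 0\<^sub>v n"
  proof (rule ccontr)
    assume "\<not> ?thesis"
    then have "x $ i = 0 \<and> y $ i = 0" if "i < n" for i using that by simp
    then have "v = 0\<^sub>v n" using v(1) by (intro eq_vecI) (auto simp: x_def y_def complex_eq_iff)
    with v show False by simp
  qed
  moreover have less: "q (F *\<^sub>v u) < q u" if "u \<in> carrier_vec n" "u \<noteq> 0\<^sub>v n" for u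
    using decr[OF that] by (simp add: q_def)
  moreover have "F *\<^sub>v 0\<^sub>v n = 0\<^sub>v n" using F by (intro eq_vecI) auto
  then have "q (F *\<^sub>v u) \<le> q u" if "u \<in> carrier_vec n" for u
    using less[OF that] by (cases "u = 0\<^sub>v n") auto
  ultimately have "q (F *\<^sub>v x) + q (F *\<^sub>v y) < q x + q y"
    using xy by (meson add_less_le_mono add_le_less_mono)
  moreover have "q (F *\<^sub>v x) + q (F *\<^sub>v y) = (a\<^sup>2 + b\<^sup>2) * (q x + q y)"
    unfolding Fx Fy q_def by (rule quadratic_form_rotation[OF M xy])
  moreover have "0 \<le> q x + q y" using nonneg xy by (simp add: q_def)
  \<comment> \<open>If \<open>a^2 + b^2\<close> were at least 1, nonnegativity of
    \<open>q x + q y\<close> would make the product at least \<open>q x + q y\<close>, against the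
    strict decrease.\<close>
  ultimately have "a\<^sup>2 + b\<^sup>2 < 1"
    using mult_right_mono[of 1 "a\<^sup>2 + b\<^sup>2" "q x + q y"] by (cases "a\<^sup>2 + b\<^sup>2 < 1") auto
  then have "cmod \<mu> < 1" by (simp add: cmod_def a_def b_def)
  with l show ?thesis by simp
qed

section \<open>Gain and Riccati equation in terms of the closed loop\<close>

text \<open>The optimal gain written through the closed loop \<open>F = A + B K\<close>: from
  \<open>(R + \<gamma> B\<^sup>T P B) K = -\<gamma> B\<^sup>T P A\<close> one gets \<open>R K = -\<gamma> B\<^sup>T P F\<close>.\<close>

lemma gain_closed_loop:
  fixes A B P R K :: "real mat"
  assumes A: "A \<in> carrier_mat n n" and B: "B \<in> carrier_mat n m" and P: "P \<in> carrier_mat n n"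
    and R: "R \<in> carrier_mat m m" "det R \<noteq> 0" and K: "K \<in> carrier_mat m n"
    and gain: "(R + \<gamma> \<cdot>\<^sub>m (transpose_mat B * P * B)) * K = (- \<gamma>) \<cdot>\<^sub>m (transpose_mat B * P * A)"
  shows "K = (- \<gamma>) \<cdot>\<^sub>m (mat_inv R * (transpose_mat B * P * (A + B * K)))"
proof -
  let ?C = "transpose_mat B * P"
  have C: "?C \<in> carrier_mat m n" using B P by simp
  have CB: "?C * B \<in> carrier_mat m m" using C B by simp
  have CA: "?C * A \<in> carrier_mat m n" using C A by simp
  have BK: "B * K \<in> carrier_mat n n" using B K by simp
  have RK: "R * K \<in> carrier_mat m n" using R(1) K by simp
  have CBK: "?C * (B * K) \<in> carrier_mat m n" using C BK by simp
  note inv = mat_inv[OF R]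
  have "R * K + \<gamma> \<cdot>\<^sub>m (?C * (B * K)) = (- \<gamma>) \<cdot>\<^sub>m (?C * A)"
    using gain add_mult_distrib_mat[OF R(1) smult_carrier_mat[OF CB] K]
      mult_smult_assoc_mat[OF CB K] assoc_mult_mat[OF C B K] by simp
  \<comment> \<open>Deleting \<open>index_mult_mat\<close> keeps the matrix products atomic, so the
    entrywise goal is a plain additive cancellation.\<close>
  moreover have "R * K = (R * K + \<gamma> \<cdot>\<^sub>m (?C * (B * K))) - \<gamma> \<cdot>\<^sub>m (?C * (B * K))"
    using RK CBK by (intro eq_matI) (auto simp del: index_mult_mat)
  ultimately have e: "R * K = (- \<gamma>) \<cdot>\<^sub>m (?C * A) - \<gamma> \<cdot>\<^sub>m (?C * (B * K))"
    by simp
  have "R * K = (- \<gamma>) \<cdot>\<^sub>m (?C * (A + B * K))"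
    unfolding e mult_add_distrib_mat[OF C A BK] using CA CBK
    by (intro eq_matI) (auto simp: algebra_simps simp del: index_mult_mat)
  then have "mat_inv R * (R * K) = (- \<gamma>) \<cdot>\<^sub>m (mat_inv R * (?C * (A + B * K)))"
    using mult_smult_distrib[OF inv(1), of "?C * (A + B * K)" n "- \<gamma>"] C A BK by simp
  moreover have "mat_inv R * (R * K) = K"
    using assoc_mult_mat[OF inv(1) R(1) K] inv(3) K by simp
  ultimately show ?thesis by simp
qed

text \<open>Pulling \<open>\<gamma> A^T P\<close> out on the left leaves
  \<open>A - \<gamma> B N B^T P A\<close>, which is \<open>A + B K\<close>. Here \<open>N\<close>
  stands for the inverse of \<open>R + \<gamma> B^T P B\<close>.\<close>

lemma riccati_closed_loop:
  fixes A B P Q K N :: "real mat"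
  assumes A: "A \<in> carrier_mat n n" and B: "B \<in> carrier_mat n m" and P: "P \<in> carrier_mat n n"
    and Q: "Q \<in> carrier_mat n n" and N: "N \<in> carrier_mat m m"
    and ric: "P = \<gamma> \<cdot>\<^sub>m (transpose_mat A * P * A)
      - \<gamma>\<^sup>2 \<cdot>\<^sub>m (transpose_mat A * P * B * N * transpose_mat B * P * A) + Q"
    and K: "K = (- \<gamma>) \<cdot>\<^sub>m (N * transpose_mat B * P * A)"
  shows "P = \<gamma> \<cdot>\<^sub>m (transpose_mat A * (P * (A + B * K))) + Q"
proof -
  let ?D = "transpose_mat A * P" and ?H = "N * transpose_mat B * P * A"
  have At: "transpose_mat A \<in> carrier_mat n n" and Bt: "transpose_mat B \<in> carrier_mat m n"
    using A B by auto
  have D: "?D \<in> carrier_mat n n" using At P by simp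
  have NB: "N * transpose_mat B \<in> carrier_mat m n" using N Bt by simp
  have NBP: "N * transpose_mat B * P \<in> carrier_mat m n" using NB P by simp
  have H: "?H \<in> carrier_mat m n" using NBP A by simp
  have Kc: "K \<in> carrier_mat m n" using H K by simp
  have DB: "?D * B \<in> carrier_mat n m" using D B by simp
  have BK: "B * K \<in> carrier_mat n n" using B Kc by simp
  have DA: "?D * A \<in> carrier_mat n n" using D A by simp
  have DBH: "?D * B * ?H \<in> carrier_mat n n" using DB H by simp
  have e1: "?D * B * N * transpose_mat B * P * A = ?D * B * ?H"
    using assoc_mult_mat[OF DB N Bt] assoc_mult_mat[OF DB NB P] assoc_mult_mat[OF DB NBP A] by simp
  have e2: "?D * (B * K) = (- \<gamma>) \<cdot>\<^sub>m (?D * B * ?H)"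
    using assoc_mult_mat[OF D B Kc] mult_smult_distrib[OF DB H] K by simp
  have e3: "transpose_mat A * (P * (A + B * K)) = ?D * A + ?D * (B * K)"
    using assoc_mult_mat[OF At P add_carrier_mat[OF BK, of A]] mult_add_distrib_mat[OF D A BK] by simp
  have "\<gamma> \<cdot>\<^sub>m (?D * A) - \<gamma>\<^sup>2 \<cdot>\<^sub>m (?D * B * ?H) = \<gamma> \<cdot>\<^sub>m (?D * A + (- \<gamma>) \<cdot>\<^sub>m (?D * B * ?H))"
    using DA DBH
    by (intro eq_matI) (auto simp: algebra_simps power2_eq_square simp del: index_mult_mat)
  with ric show ?thesis unfolding e1 e3 e2 by simp
qed

section \<open>The Lyapunov function of the closed loop\<close>

theorem theorem1:
  fixes n m :: nat and A B Q R P K :: "real mat" and \<gamma> :: real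
  assumes "n > 0" and "m > 0"
    and "A \<in> carrier_mat n n" and "B \<in> carrier_mat n m"
    and "stabilizable n m A B"
    and "pos_def_mat n Q" and "pos_def_mat m R"
    and "0 \<le> \<gamma>" and "\<gamma> \<le> 1"
    and "pos_def_mat n P"
    and "P = \<gamma> \<cdot>\<^sub>m (transpose_mat A * P * A)
           - \<gamma>\<^sup>2 \<cdot>\<^sub>m (transpose_mat A * P * B
               * mat_inv (R + \<gamma> \<cdot>\<^sub>m (transpose_mat B * P * B))
               * transpose_mat B * P * A)
           + Q"
    and "K = (- \<gamma>) \<cdot>\<^sub>m (mat_inv (R + \<gamma> \<cdot>\<^sub>m (transpose_mat B * P * B)) * transpose_mat B * P * A)"
    and "pos_def_mat n (\<gamma>\<^sup>2 \<cdot>\<^sub>m (P * B * mat_inv R * transpose_mat B * P) + Q + (\<gamma> - 1) \<cdot>\<^sub>m P)"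
  shows "K \<in> stabilizing_gains n m A B"
proof -
  note A = assms(3) and B = assms(4) and Qpd = assms(6) and Rpd = assms(7) and g = assms(8)
    and Ppd = assms(10) and ric = assms(11) and Kdef = assms(12) and cond = assms(13)
  have P: "P \<in> carrier_mat n n" "transpose_mat P = P" and R: "R \<in> carrier_mat m m"
    and Q: "Q \<in> carrier_mat n n"
    using Ppd Qpd Rpd by (auto simp: pos_def_mat_def)
  have Bt: "transpose_mat B \<in> carrier_mat m n" using B by simp
  let ?C = "transpose_mat B * P"
  have C: "?C \<in> carrier_mat m n" using Bt P by simp
  have CA: "?C * A \<in> carrier_mat m n" using C A by simp
  have CB: "?C * B \<in> carrier_mat m m" using C B by simp
  define S where "S = R + \<gamma> \<cdot>\<^sub>m (?C * B)"
  have S: "S \<in> carrier_mat m m" using CB by (simp add: S_def)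
  \<comment> \<open>The form of \<open>S\<close> at \<open>u\<close> is that of \<open>R\<close> at
    \<open>u\<close>, which is positive, plus \<open>\<gamma>\<close> times that of \<open>P\<close>
    at \<open>B u\<close>, which is nonnegative.\<close>
  have "det S \<noteq> 0"
  proof (rule det_nonzero_if_quadratic_form_pos[OF S])
    fix u :: "real vec" assume u: "u \<in> carrier_vec m" "u \<noteq> 0\<^sub>v m"
    have "u \<bullet> ((?C * B) *\<^sub>v u) = (B *\<^sub>v u) \<bullet> (P *\<^sub>v (B *\<^sub>v u))"
      using quadratic_form_conj[OF Bt P(1) u(1)] by simp
    also have "\<dots> \<ge> 0" using B by (intro pos_def_mat_nonneg[OF Ppd]) (use u in simp)
    finally have "0 \<le> \<gamma> * (u \<bullet> ((?C * B) *\<^sub>v u))" using g by simp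
    moreover have "0 < u \<bullet> (R *\<^sub>v u)" using Rpd u by (simp add: pos_def_mat_def)
    moreover have "u \<bullet> (S *\<^sub>v u) = u \<bullet> (R *\<^sub>v u) + \<gamma> * (u \<bullet> ((?C * B) *\<^sub>v u))"
    proof -
      have "S *\<^sub>v u = R *\<^sub>v u + \<gamma> \<cdot>\<^sub>v ((?C * B) *\<^sub>v u)"
        unfolding S_def
        using add_mult_distrib_mat_vec[OF R smult_carrier_mat[OF CB] u(1)]
          smult_mat_mult_mat_vec_assoc[OF CB u(1)] by simp
      then show ?thesis
        using scalar_prod_add_distrib[OF u(1), of "R *\<^sub>v u" "\<gamma> \<cdot>\<^sub>v ((?C * B) *\<^sub>v u)"] R CB u B by simp
    qed
    ultimately show "0 < u \<bullet> (S *\<^sub>v u)" by simp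
  qed
  note Sinv = mat_inv[OF S this] and Rinv = mat_inv[OF R pos_def_mat_det_nonzero[OF Rpd]]
  have K1: "K = (- \<gamma>) \<cdot>\<^sub>m (mat_inv S * (?C * A))"
    using Kdef assoc_mult_mat[OF Sinv(1) Bt P(1)] assoc_mult_mat[OF Sinv(1) C A]
    by (simp add: S_def)
  have K: "K \<in> carrier_mat m n" using K1 Sinv(1) CA by simp
  \<comment> \<open>Multiplying by \<open>S\<close> removes its inverse and gives the gain equation
    in the form that \<open>gain_closed_loop\<close> takes.\<close>
  have "S * K = (- \<gamma>) \<cdot>\<^sub>m (?C * A)"
    unfolding K1 using mult_smult_distrib[OF S mult_carrier_mat[OF Sinv(1) CA]]
      assoc_mult_mat[OF S Sinv(1) CA] Sinv(2) left_mult_one_mat[OF CA] by simp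
  then have K2: "K = (- \<gamma>) \<cdot>\<^sub>m (mat_inv R * (?C * (A + B * K)))"
    unfolding S_def
    by (rule gain_closed_loop[OF A B P(1) R pos_def_mat_det_nonzero[OF Rpd] K])
  define F where "F = A + B * K"
  have BK: "B * K \<in> carrier_mat n n" using B K by simp
  have F: "F \<in> carrier_mat n n" using BK by (simp add: F_def)
  have ric2: "P = \<gamma> \<cdot>\<^sub>m (transpose_mat A * (P * F)) + Q"
    unfolding F_def
    by (rule riccati_closed_loop[OF A B P(1) Q Sinv(1)]) (use ric Kdef in \<open>simp_all only: S_def\<close>)
  \<comment> \<open>This \<open>G\<close> includes the outer factors \<open>P\<close>: it is the
    product written \<open>P G P\<close> in the overview.\<close>
  define G where "G = P * B * mat_inv R * transpose_mat B * P"
  have PB: "P * B \<in> carrier_mat n m" using P B by simp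
  have PBt: "transpose_mat (P * B) = ?C" using transpose_mult[OF P(1) B] P by simp
  have G: "G \<in> carrier_mat n n"
    unfolding G_def using B Rinv(1) Bt P(1) by (intro mult_carrier_mat)
  have Geq: "G = P * B * mat_inv R * transpose_mat (P * B)"
    unfolding G_def PBt using assoc_mult_mat[OF mult_carrier_mat[OF PB Rinv(1)] Bt P(1)] by simp
  have Gq: "x \<bullet> (G *\<^sub>v x) = (?C *\<^sub>v x) \<bullet> (mat_inv R *\<^sub>v (?C *\<^sub>v x))" if "x \<in> carrier_vec n" for x
    using quadratic_form_conj[OF PB Rinv(1) that] unfolding Geq PBt .
  define M where "M = \<gamma> \<cdot>\<^sub>m P + \<gamma>\<^sup>2 \<cdot>\<^sub>m G"
  have M: "M \<in> carrier_mat n n" using G by (simp add: M_def)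
  have Mq: "x \<bullet> (M *\<^sub>v x) = \<gamma> * (x \<bullet> (P *\<^sub>v x)) + \<gamma>\<^sup>2 * (x \<bullet> (G *\<^sub>v x))"
    if x: "x \<in> carrier_vec n" for x
  proof -
    have "M *\<^sub>v x = \<gamma> \<cdot>\<^sub>v (P *\<^sub>v x) + \<gamma>\<^sup>2 \<cdot>\<^sub>v (G *\<^sub>v x)"
      unfolding M_def
      using add_mult_distrib_mat_vec[OF smult_carrier_mat[OF P(1)] smult_carrier_mat[OF G] x]
        smult_mat_mult_mat_vec_assoc[OF P(1) x] smult_mat_mult_mat_vec_assoc[OF G x] by simp
    then show ?thesis
      using scalar_prod_add_distrib[OF x, of "\<gamma> \<cdot>\<^sub>v (P *\<^sub>v x)" "\<gamma>\<^sup>2 \<cdot>\<^sub>v (G *\<^sub>v x)"] P G x by simp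
  qed
  have "real_spectral_radius F < 1"
  proof (rule discrete_lyapunov[OF assms(1) F M])
    fix x :: "real vec" assume x: "x \<in> carrier_vec n"
    have "0 \<le> x \<bullet> (G *\<^sub>v x)"
      unfolding Gq[OF x] by (rule pos_def_mat_inv_nonneg[OF Rpd mult_mat_vec_carrier[OF C x]])
    then show "0 \<le> x \<bullet> (M *\<^sub>v x)"
      unfolding Mq[OF x] using g pos_def_mat_nonneg[OF Ppd x] by simp
    assume x0: "x \<noteq> 0\<^sub>v n"
    define w where "w = F *\<^sub>v x"
    have w: "w \<in> carrier_vec n" using F x by (simp add: w_def)
    have Pw: "P *\<^sub>v w \<in> carrier_vec n" using P w by simp
    \<comment> \<open>Chosen so that \<open>K x = -\<gamma> z\<close> by \<open>K2\<close>; then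
      \<open>B z\<close> is the difference between \<open>A x\<close> and \<open>w = F x\<close> up
      to the factor \<open>\<gamma>\<close>.\<close>
    define z where "z = mat_inv R *\<^sub>v (?C *\<^sub>v w)"
    have Cw: "?C *\<^sub>v w \<in> carrier_vec m" by (rule mult_mat_vec_carrier[OF C w])
    have z: "z \<in> carrier_vec m" unfolding z_def by (rule mult_mat_vec_carrier[OF Rinv(1) Cw])
    have Bz: "B *\<^sub>v z \<in> carrier_vec n" by (rule mult_mat_vec_carrier[OF B z])
    have Ax: "A *\<^sub>v x \<in> carrier_vec n" by (rule mult_mat_vec_carrier[OF A x])
    have CF: "?C * F \<in> carrier_mat m n" by (rule mult_carrier_mat[OF C F])
    have "K *\<^sub>v x = (- \<gamma>) \<cdot>\<^sub>v z"
      using arg_cong[OF K2, of "\<lambda>X. X *\<^sub>v x"]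
        smult_mat_mult_mat_vec_assoc[OF mult_carrier_mat[OF Rinv(1) CF] x]
        assoc_mult_mat_vec[OF Rinv(1) CF x] assoc_mult_mat_vec[OF C F x]
      unfolding F_def[symmetric] z_def w_def by simp
    then have "w = A *\<^sub>v x + (- \<gamma>) \<cdot>\<^sub>v (B *\<^sub>v z)"
      using add_mult_distrib_mat_vec[OF A BK x] assoc_mult_mat_vec[OF B K x]
        mult_mat_vec[OF B z, of "- \<gamma>"] by (simp add: w_def F_def)
    then have Axw: "A *\<^sub>v x = w + \<gamma> \<cdot>\<^sub>v (B *\<^sub>v z)"
      using Ax Bz by (intro eq_vecI) (auto simp del: index_mult_mat_vec dim_mult_mat_vec)
    \<comment> \<open>The closed-loop Riccati equation as a quadratic form at \<open>x\<close>. In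
      the chain that follows, \<open>A^T\<close> is moved to \<open>x\<close> and \<open>A x\<close>
      is replaced through \<open>Axw\<close>, so that only forms in \<open>w\<close> remain beside
      the \<open>Q\<close> term.\<close>
    have "x \<bullet> (P *\<^sub>v x) = \<gamma> * (x \<bullet> (transpose_mat A *\<^sub>v (P *\<^sub>v w))) + x \<bullet> (Q *\<^sub>v x)"
    proof -
      have PF: "P * F \<in> carrier_mat n n" using P F by simp
      have At: "transpose_mat A \<in> carrier_mat n n" using A by simp
      have AtPF: "transpose_mat A * (P * F) \<in> carrier_mat n n" using At PF by simp
      have "P *\<^sub>v x = \<gamma> \<cdot>\<^sub>v (transpose_mat A *\<^sub>v (P *\<^sub>v w)) + Q *\<^sub>v x"
        using arg_cong[OF ric2, of "\<lambda>X. X *\<^sub>v x"]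
          add_mult_distrib_mat_vec[OF smult_carrier_mat[OF AtPF] Q x]
          smult_mat_mult_mat_vec_assoc[OF AtPF x] assoc_mult_mat_vec[OF At PF x]
          assoc_mult_mat_vec[OF P(1) F x] unfolding w_def by simp
      moreover have "transpose_mat A *\<^sub>v (P *\<^sub>v w) \<in> carrier_vec n"
        by (rule mult_mat_vec_carrier[OF At Pw])
      ultimately show ?thesis
        using scalar_prod_add_distrib[OF x, of "\<gamma> \<cdot>\<^sub>v (transpose_mat A *\<^sub>v (P *\<^sub>v w))" "Q *\<^sub>v x"] Q x
        by simp
    qed
    also have "x \<bullet> (transpose_mat A *\<^sub>v (P *\<^sub>v w)) = (P *\<^sub>v w) \<bullet> (A *\<^sub>v x)"
      using transpose_vec_mult_scalar[OF A x Pw] A Pw x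
      by (metis comm_scalar_prod mult_mat_vec_carrier transpose_carrier_mat)
    also have "\<dots> = w \<bullet> (P *\<^sub>v w) + \<gamma> * ((P *\<^sub>v w) \<bullet> (B *\<^sub>v z))"
      using scalar_prod_add_distrib[OF Pw w smult_carrier_vec[THEN iffD2, OF Bz, of \<gamma>]]
        comm_scalar_prod[OF Pw w] Pw Bz by (simp add: Axw)
    \<comment> \<open>Both sides equal \<open>(B^T P w)^T R^-1 (B^T P w)\<close>.\<close>
    also have "(P *\<^sub>v w) \<bullet> (B *\<^sub>v z) = w \<bullet> (G *\<^sub>v w)"
      using transpose_vec_mult_scalar[OF B z Pw] assoc_mult_mat_vec[OF Bt P(1) w] Gq[OF w]
      by (simp add: z_def)
    finally have "x \<bullet> (P *\<^sub>v x) - x \<bullet> (Q *\<^sub>v x) = w \<bullet> (M *\<^sub>v w)"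
      unfolding Mq[OF w] by (simp add: power2_eq_square algebra_simps)
    \<comment> \<open>The assumed definiteness evaluated at \<open>x\<close>. By \<open>Mq\<close>
      the right-hand side is \<open>x^T M x - (x^T P x - x^T Q x)\<close>, and the bracket was just
      identified as \<open>w^T M w\<close>, so this is the required decrease.\<close>
    moreover have "0 < \<gamma>\<^sup>2 * (x \<bullet> (G *\<^sub>v x)) + x \<bullet> (Q *\<^sub>v x) + (\<gamma> - 1) * (x \<bullet> (P *\<^sub>v x))"
    proof -
      let ?L = "\<gamma>\<^sup>2 \<cdot>\<^sub>m G" and ?N = "(\<gamma> - 1) \<cdot>\<^sub>m P"
      have L: "?L \<in> carrier_mat n n" and N: "?N \<in> carrier_mat n n" using G P by auto
      have "(?L + Q + ?N) *\<^sub>v x = (\<gamma>\<^sup>2 \<cdot>\<^sub>v (G *\<^sub>v x) + Q *\<^sub>v x) + (\<gamma> - 1) \<cdot>\<^sub>v (P *\<^sub>v x)"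
        using add_mult_distrib_mat_vec[OF add_carrier_mat[OF Q, of ?L] N x]
          add_mult_distrib_mat_vec[OF L Q x]
          smult_mat_mult_mat_vec_assoc[OF P(1) x] smult_mat_mult_mat_vec_assoc[OF G x] by simp
      moreover have "0 < x \<bullet> ((?L + Q + ?N) *\<^sub>v x)"
        using cond x x0 unfolding G_def pos_def_mat_def by blast
      moreover have "G *\<^sub>v x \<in> carrier_vec n" "Q *\<^sub>v x \<in> carrier_vec n" "P *\<^sub>v x \<in> carrier_vec n"
        using G Q P x by auto
      ultimately show ?thesis
        using x by (simp add: scalar_prod_add_distrib[where n = n])
    qed
    ultimately show "(F *\<^sub>v x) \<bullet> (M *\<^sub>v (F *\<^sub>v x)) < x \<bullet> (M *\<^sub>v x)"
      unfolding w_def[symmetric] Mq[OF x] by (simp add: algebra_simps)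
  qed
  with K show ?thesis by (simp add: stabilizing_gains_def F_def)
qed

end
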